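(* Let $A,a$ be positive integers with $a>A$. Then for every non-negative integer $n$, $$p_{A,a}(n-(a-A))=\overline{p}_{A,a-A}(n).$$
   Context: A partition of $n$ is a finite multiset of positive integers summing to $n$. For positive integers $A,a$ and a partition $\pi$, $\mathrm{mex}_{A,a}(\pi)$ is the smallest element of $\{a,a+A,a+2A,\dots\}$ that is not a part of $\pi$. $p_{A,a}(n)$ (resp. $\overline{p}_{A,a}(n)$) is the number of partitions $\pi$ of $n$ with $\mathrm{mex}_{A,a}(\pi)\equiv a \pmod{2A}$ (resp. $\equiv A+a \pmod{2A}$); by convention $p_{A,a}(m)=0$ for $m<0$. *)

theory Defs
  imports "HOL-Library.Multiset" "HOL-Number_Theory.Cong"
begin

definition partitions :: "nat \<Rightarrow> nat multiset set" where
  "partitions n = {\<pi>. 0 \<notin># \<pi> \<and> \<Sum>\<^sub># \<pi> = n}"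

text \<open>In \<open>mex A a \<pi>\<close> the modulus \<open>A\<close> comes first, as in the subscript notation
  $\mathrm{mex}_{A,a}(\pi)$. The minimum is attained whenever \<open>A > 0\<close>.\<close>

definition mex :: "nat \<Rightarrow> nat \<Rightarrow> nat multiset \<Rightarrow> nat" where
  "mex A a \<pi> = (LEAST x. x \<in> {a + k * A | k. True} \<and> x \<notin># \<pi>)"

text \<open>The argument is an integer because the theorem evaluates the function at a possibly
  negative number, where it is zero by convention.\<close>

definition p_mex :: "nat \<Rightarrow> nat \<Rightarrow> int \<Rightarrow> nat" where
  "p_mex A a m =
    (if m < 0 then 0
     else card {\<pi> \<in> partitions (nat m). [mex A a \<pi> = a] (mod (2 * A))})"

definition pbar_mex :: "nat \<Rightarrow> nat \<Rightarrow> nat \<Rightarrow> nat" where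
  "pbar_mex A a n =
    card {\<pi> \<in> partitions n. [mex A a \<pi> = A + a] (mod (2 * A))}"

lemma finite_partitions: "finite (partitions n)"
proof -
  have bound: "x \<le> n" if "\<Sum>\<^sub># \<pi> = n" "x \<in># \<pi>" for x and \<pi> :: "nat multiset"
    using that by (auto dest: multi_member_split)
  have size_le: "size \<pi> \<le> \<Sum>\<^sub># \<pi>" if "0 \<notin># \<pi>" for \<pi> :: "nat multiset"
    using that by (induction \<pi>) auto
  have "partitions n \<subseteq> mset ` {xs. set xs \<subseteq> {..n} \<and> length xs \<le> n}"
  proof
    fix \<pi> assume \<pi>: "\<pi> \<in> partitions n"
    obtain xs where xs: "mset xs = \<pi>" using ex_mset by blast
    have "set xs \<subseteq> {..n}"
      using \<pi> xs bound[of \<pi>] by (auto simp: partitions_def)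
    moreover have "length xs \<le> n"
      using \<pi> xs size_le[of \<pi>] by (auto simp: partitions_def)
    ultimately show "\<pi> \<in> mset ` {xs. set xs \<subseteq> {..n} \<and> length xs \<le> n}"
      using xs by blast
  qed
  then show ?thesis
    using finite_lists_length_le[of "{..n}" n] finite_subset by blast
qed

lemma mex_exists:
  fixes A a :: nat
  assumes "A > 0"
  shows "\<exists>x. x \<in> {a + k * A | k. True} \<and> x \<notin># \<pi>"
proof (rule ccontr)
  assume "\<not> ?thesis"
  then have "range (\<lambda>k. a + k * A) \<subseteq> set_mset \<pi>" by blast
  then have "finite (range (\<lambda>k. a + k * A))" by (rule finite_subset) simp
  moreover have "inj (\<lambda>k. a + k * A)" using assms by (intro injI) simp
  ultimately show False using finite_imageD infinite_UNIV_nat by blast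
qed

end

theory Submission
  imports Defs
begin

text \<open>Inserting the part \<open>b = a - A\<close> is the bijection: a partition whose \<open>b\<close>-mex is
  congruent to \<open>A + b\<close> modulo \<open>2 * A\<close> must contain \<open>b\<close>, and once \<open>b\<close> is present the
  search for the mex starts at \<open>b + A = a\<close>, where the copies of \<open>b\<close> play no role.\<close>

lemma mex_eq_start:
  assumes "b \<notin># \<pi>"
  shows "mex A b \<pi> = b"
  unfolding mex_def using assms
  by (intro Least_equality) (auto intro: exI[of _ 0])

lemma mex_add_mset_start:
  assumes "A > 0"
  shows "mex A b (add_mset b \<pi>) = mex A (b + A) \<pi>"
proof -
  have "(\<exists>k. x = b + k * A) \<and> x \<noteq> b \<longleftrightarrow> (\<exists>k. x = b + A + k * A)" for x
  proof
    assume "(\<exists>k. x = b + k * A) \<and> x \<noteq> b"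
    then obtain k where k: "x = b + k * A" "x \<noteq> b" by blast
    then obtain j where "k = Suc j" by (cases k) auto
    with k show "\<exists>k. x = b + A + k * A" by auto
  next
    assume "\<exists>k. x = b + A + k * A"
    then obtain k where "x = b + A + k * A" by blast
    then have "x = b + Suc k * A" "x \<noteq> b" using assms by auto
    then show "(\<exists>k. x = b + k * A) \<and> x \<noteq> b" by blast
  qed
  \<comment> \<open>Avoiding \<open>add_mset b \<pi>\<close> means avoiding \<open>\<pi>\<close> and
    differing from \<open>b\<close>; the latter condition is absorbed into the progression.\<close>
  then have "(\<lambda>x. x \<in> {b + k * A | k. True} \<and> x \<notin># add_mset b \<pi>) =
      (\<lambda>x. x \<in> {b + A + k * A | k. True} \<and> x \<notin># \<pi>)"
    by (intro ext) auto
  then show ?thesis by (simp only: mex_def)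
qed

text \<open>Otherwise the mex is \<open>b\<close> itself, and \<open>b\<close> and
  \<open>A + b\<close> differ by \<open>A\<close>, which is not a multiple of
  \<open>2 * A\<close>.\<close>

lemma start_in_partition_if_mex_cong:
  assumes "A > 0" and "[mex A b \<pi> = A + b] (mod (2 * A))"
  shows "b \<in># \<pi>"
proof (rule ccontr)
  assume "b \<notin># \<pi>"
  then have "[b + 0 = b + A] (mod (2 * A))"
    using assms(2) by (simp add: mex_eq_start add.commute)
  then have "[0 = A] (mod (2 * A))" by (simp only: cong_add_lcancel_nat)
  with assms(1) show False by (simp add: cong_def)
qed

text \<open>The conjunct \<open>b \<le> n\<close> guards against truncated subtraction: for
  \<open>n < b\<close> the empty partition would lie in \<open>partitions (n - b)\<close>.\<close>

lemma add_mset_in_partitions_iff: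
  assumes "b > 0"
  shows "add_mset b \<pi> \<in> partitions n \<longleftrightarrow> b \<le> n \<and> \<pi> \<in> partitions (n - b)"
  using assms by (auto simp: partitions_def)

theorem theorem5p1:
  fixes A a n :: nat
  assumes "A > 0" and "a > 0" and "a > A"
  shows "p_mex A a (int n - (int a - int A)) = pbar_mex A (a - A) n"
proof -
  define b where "b = a - A"
  have b: "b > 0" "a = b + A" using assms by (auto simp: b_def)
  let ?P = "{\<pi> \<in> partitions (n - b). [mex A a \<pi> = a] (mod (2 * A))}"
  let ?Q = "{\<pi> \<in> partitions n. [mex A b \<pi> = A + b] (mod (2 * A))}"
  have Q_iff: "add_mset b \<pi> \<in> ?Q \<longleftrightarrow> b \<le> n \<and> \<pi> \<in> ?P" for \<pi>
    using b assms(1)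
    by (simp add: add_mset_in_partitions_iff mex_add_mset_start add.commute)
  have Q_cases: "\<exists>\<rho>. \<pi> = add_mset b \<rho>" if "\<pi> \<in> ?Q" for \<pi>
    using that start_in_partition_if_mex_cong[OF assms(1)]
    by (auto dest: multi_member_split)
  have shift: "int n - (int a - int A) = int n - int b" using b by simp
  show ?thesis
  proof (cases "b \<le> n")
    case True
    \<comment> \<open>\<open>Q_cases\<close> supplies a preimage for each member of
      \<open>?Q\<close>, and \<open>Q_iff\<close> places it in \<open>?P\<close>.\<close>
    have "?Q = add_mset b ` ?P"
      using Q_iff Q_cases True by blast
    then have "card ?Q = card ?P"
      by (simp only:) (intro card_image, auto simp: inj_on_def)
    moreover have "nat (int n - int b) = n - b" by simp
    ultimately show ?thesis
      unfolding shift p_mex_def pbar_mex_def b_def[symmetric] using True by simp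
  next
    case False
    \<comment> \<open>A member of \<open>?Q\<close> would contain the part \<open>b > n\<close>. On
      the other side the argument of \<open>p_mex\<close> is negative, so its value is 0 by
      convention.\<close>
    then have "?Q = {}"
      using Q_iff Q_cases by blast
    then have "card ?Q = 0" by (simp only: card.empty)
    then show ?thesis
      unfolding shift p_mex_def pbar_mex_def b_def[symmetric] using False by simp
  qed
qed

end
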